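(* For variables $a,b$ and a variable $x$ distinct from them, the formula $a\sqsubseteq V\Rightarrow\big(\{x\mid x\in a\}\sqsubseteq\{x\mid x\in b\}\Rightarrow a\sqsubseteq b\big)$ is derivable.
   Context: Formal system. Objects are generated from the constant $\varnothing$ by: $(\alpha)^{\mathsf c}$, $(\alpha)^{\mathsf v}$ (variables are objects of this form), $(\alpha\,\&\,\beta)$ (federation), $(\alpha\Rightarrow\beta)$ (containment/implication), $(\alpha\cap\beta)$, and classes $\{x\mid\beta\}$ ($x$ a variable, which becomes a bound index). $\alpha[x:=\beta]$ replaces every free appearance of $x$ by $\beta$. Abbreviations: $\bot:=\varnothing^{\mathsf c}$; $\neg a:=(a\Rightarrow\bot)$; $\bar a:=(\varnothing\Rightarrow a)$; $a\vee b:=\overline{\bar a\cap\bar b}$; $a=b:=(a\Rightarrow b)\&(b\Rightarrow a)$; $a\neq b:=\neg(a=b)$; $a\sqsubseteq b:=(b\Rightarrow a)$; $\mathrm{Sing}(a):=(\bar a\neq a)\,\&\,((a\Rightarrow b)\Rightarrow(\bar b\vee a=b))$, with $b$ a variable; $a\in b:=\mathrm{Sing}(a)\&(b\Rightarrow a)$; $V:=\{x\mid\varnothing\}$. Relations $\sqsubseteq,\in,=$ bind more tightly than $\Rightarrow$. Rules: R1 from $\alpha$ and $\alpha\Rightarrow\beta$ infer $\beta$; R2 from $\alpha$ infer $\alpha[x:=\beta]$; R3 if $x$ does not appear in $\gamma$, from $\gamma\Rightarrow(\alpha\Rightarrow\beta)$ infer $\gamma\Rightarrow(\{x\mid\beta\}\Rightarrow\{x\mid\alpha\})$.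 Axioms ($a,b,c,d,x$ variables): A1 $((c\Rightarrow a)\&(c\Rightarrow(a\Rightarrow b)))\Rightarrow(c\Rightarrow b)$; A2 $((d\Rightarrow(a\Rightarrow b))\&(d\Rightarrow(b\Rightarrow c)))\Rightarrow(d\Rightarrow(a\Rightarrow c))$; A3 $((c\Rightarrow a)\&(c\Rightarrow b))\Rightarrow(c\Rightarrow(a\&b))$; A4 $(a\&b)\Rightarrow a$, $(a\&b)\Rightarrow b$; A5 $a\Rightarrow(a\cap b)$, $b\Rightarrow(a\cap b)$; A6 $((a\Rightarrow c)\&(b\Rightarrow c))\Rightarrow((a\cap b)\Rightarrow c)$; A7 $a\Rightarrow a$; A8 $a\Rightarrow\varnothing$; A9 $\bot\Rightarrow a$; A10 $(\varnothing\Rightarrow a)\Rightarrow((\varnothing\Rightarrow b)\Rightarrow(a\&b))$; A11 $(a\Rightarrow b)\Rightarrow(\varnothing\Rightarrow(a\Rightarrow b))$; A12 $(((a\Rightarrow b)\Rightarrow\bot)\Rightarrow\bot)\Rightarrow(a\Rightarrow b)$; A13 (schema) $a\in\{x\mid\alpha\}=(\mathrm{Sing}(a)\&\alpha[x:=a])$; A14a $a\Rightarrow\{x\mid x\in a\}$; A14b $(V\Rightarrow a)\Rightarrow(\{x\mid x\in a\}\Rightarrow a)$. *)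

theory Defs
  imports Main
begin

text \<open>
  Locally nameless syntax: \<open>Bnd\<close> is a de Bruijn index, so terms of the datatype are objects
  up to renaming of bound indices, and substitution of an object cannot be captured.
  Not every term is an object; see the predicate \<open>object\<close> below.
\<close>

datatype expr =
    Bnd nat
  | Emp                    ("\<^bold>\<emptyset>")
  | Con expr
  | Var expr
  | Fed expr expr          (infixr "\<^bold>&" 65)
  | Imp expr expr          (infixr "\<^bold>\<Rightarrow>" 60)
  | Cap expr expr          (infixr "\<^bold>\<inter>" 65)
  | Cls expr

text \<open>
  The \<open>\<alpha>\<close> of a variable \<open>Var \<alpha>\<close> serves only as its name: a variable is atomic for
  free appearance, binding and substitution.
\<close>

primrec fv :: "expr \<Rightarrow> expr set" where
  "fv (Bnd i) = {}"
| "fv \<^bold>\<emptyset> = {}"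
| "fv (Con t) = fv t"
| "fv (Var n) = {Var n}"
| "fv (s \<^bold>& t) = fv s \<union> fv t"
| "fv (s \<^bold>\<Rightarrow> t) = fv s \<union> fv t"
| "fv (s \<^bold>\<inter> t) = fv s \<union> fv t"
| "fv (Cls t) = fv t"

primrec bind :: "nat \<Rightarrow> expr \<Rightarrow> expr \<Rightarrow> expr" where
  "bind k x (Bnd i) = Bnd i"
| "bind k x \<^bold>\<emptyset> = \<^bold>\<emptyset>"
| "bind k x (Con t) = Con (bind k x t)"
| "bind k x (Var n) = (if Var n = x then Bnd k else Var n)"
| "bind k x (s \<^bold>& t) = (bind k x s \<^bold>& bind k x t)"
| "bind k x (s \<^bold>\<Rightarrow> t) = (bind k x s \<^bold>\<Rightarrow> bind k x t)"
| "bind k x (s \<^bold>\<inter> t) = (bind k x s \<^bold>\<inter> bind k x t)"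
| "bind k x (Cls t) = Cls (bind (Suc k) x t)"

definition compr :: "expr \<Rightarrow> expr \<Rightarrow> expr" ("\<^bold>{_ \<^bold>| _\<^bold>}") where
  "\<^bold>{x \<^bold>| \<beta>\<^bold>} = Cls (bind 0 x \<beta>)"

primrec subst :: "expr \<Rightarrow> expr \<Rightarrow> expr \<Rightarrow> expr" ("_\<^bold>[_ \<^bold>:= _\<^bold>]" [100, 0, 0] 100) where
  "(Bnd i)\<^bold>[x \<^bold>:= r\<^bold>] = Bnd i"
| "\<^bold>\<emptyset>\<^bold>[x \<^bold>:= r\<^bold>] = \<^bold>\<emptyset>"
| "(Con t)\<^bold>[x \<^bold>:= r\<^bold>] = Con (t\<^bold>[x \<^bold>:= r\<^bold>])"
| "(Var n)\<^bold>[x \<^bold>:= r\<^bold>] = (if Var n = x then r else Var n)"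
| "(s \<^bold>& t)\<^bold>[x \<^bold>:= r\<^bold>] = (s\<^bold>[x \<^bold>:= r\<^bold>] \<^bold>& t\<^bold>[x \<^bold>:= r\<^bold>])"
| "(s \<^bold>\<Rightarrow> t)\<^bold>[x \<^bold>:= r\<^bold>] = (s\<^bold>[x \<^bold>:= r\<^bold>] \<^bold>\<Rightarrow> t\<^bold>[x \<^bold>:= r\<^bold>])"
| "(s \<^bold>\<inter> t)\<^bold>[x \<^bold>:= r\<^bold>] = (s\<^bold>[x \<^bold>:= r\<^bold>] \<^bold>\<inter> t\<^bold>[x \<^bold>:= r\<^bold>])"
| "(Cls t)\<^bold>[x \<^bold>:= r\<^bold>] = Cls (t\<^bold>[x \<^bold>:= r\<^bold>])"

inductive object :: "expr \<Rightarrow> bool" where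
  obj_Emp: "object \<^bold>\<emptyset>"
| obj_Con: "object \<alpha> \<Longrightarrow> object (Con \<alpha>)"
| obj_Var: "object \<alpha> \<Longrightarrow> object (Var \<alpha>)"
| obj_Fed: "object \<alpha> \<Longrightarrow> object \<beta> \<Longrightarrow> object (\<alpha> \<^bold>& \<beta>)"
| obj_Imp: "object \<alpha> \<Longrightarrow> object \<beta> \<Longrightarrow> object (\<alpha> \<^bold>\<Rightarrow> \<beta>)"
| obj_Cap: "object \<alpha> \<Longrightarrow> object \<beta> \<Longrightarrow> object (\<alpha> \<^bold>\<inter> \<beta>)"
| obj_compr: "object (Var \<nu>) \<Longrightarrow> object \<beta> \<Longrightarrow> object \<^bold>{Var \<nu> \<^bold>| \<beta>\<^bold>}"

definition variable :: "expr \<Rightarrow> bool" where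
  "variable x \<longleftrightarrow> (\<exists>\<nu>. object \<nu> \<and> x = Var \<nu>)"

definition falsum :: expr ("\<^bold>\<bottom>") where
  "\<^bold>\<bottom> = Con \<^bold>\<emptyset>"

definition neg :: "expr \<Rightarrow> expr" ("\<^bold>\<not> _" [75] 75) where
  "\<^bold>\<not> a = (a \<^bold>\<Rightarrow> \<^bold>\<bottom>)"

definition bar :: "expr \<Rightarrow> expr" where
  "bar a = (\<^bold>\<emptyset> \<^bold>\<Rightarrow> a)"

definition disj :: "expr \<Rightarrow> expr \<Rightarrow> expr" (infixr "\<^bold>\<or>" 65) where
  "a \<^bold>\<or> b = bar (bar a \<^bold>\<inter> bar b)"

definition eq :: "expr \<Rightarrow> expr \<Rightarrow> expr" (infix "\<^bold>=" 70) where
  "a \<^bold>= b = ((a \<^bold>\<Rightarrow> b) \<^bold>& (b \<^bold>\<Rightarrow> a))"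

definition neq :: "expr \<Rightarrow> expr \<Rightarrow> expr" (infix "\<^bold>\<noteq>" 70) where
  "a \<^bold>\<noteq> b = \<^bold>\<not> (a \<^bold>= b)"

definition sub :: "expr \<Rightarrow> expr \<Rightarrow> expr" (infix "\<^bold>\<sqsubseteq>" 70) where
  "a \<^bold>\<sqsubseteq> b = (b \<^bold>\<Rightarrow> a)"

text \<open>
  The definiens of \<open>Sing(a)\<close> contains a further free variable, which nothing binds. It is
  the first argument \<open>y\<close> of \<open>Sing\<close> and the subscript of membership.
\<close>

definition Sing :: "expr \<Rightarrow> expr \<Rightarrow> expr" where
  "Sing y a = ((bar a \<^bold>\<noteq> a) \<^bold>& ((a \<^bold>\<Rightarrow> y) \<^bold>\<Rightarrow> (bar y \<^bold>\<or> (a \<^bold>= y))))"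

definition mem :: "expr \<Rightarrow> expr \<Rightarrow> expr \<Rightarrow> expr" ("(_ \<^bold>\<in>\<^bsub>_\<^esub> _)" [71, 0, 71] 70) where
  "a \<^bold>\<in>\<^bsub>y\<^esub> b = (Sing y a \<^bold>& (b \<^bold>\<Rightarrow> a))"

text \<open>The index of \<open>V = {x | \<emptyset>}\<close> is immaterial; see \<open>compr_Emp\<close>.\<close>

definition univ :: expr ("\<^bold>V") where
  "\<^bold>V = \<^bold>{Var \<^bold>\<emptyset> \<^bold>| \<^bold>\<emptyset>\<^bold>}"

text \<open>
  The axioms are taken for all choices of the variables in them. The distinctness conditions in
  \<open>A14a\<close> and \<open>A14b\<close> keep \<open>a\<close> and \<open>y\<close> from being bound; in \<open>A13\<close>, \<open>y \<noteq> a\<close> keeps the variable of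
  \<open>Sing y a\<close> separate from \<open>a\<close>. Other instances follow by \<open>R2\<close>.
\<close>

inductive derivable :: "expr \<Rightarrow> bool" ("\<^bold>\<turnstile> _" [50] 50) where
  R1: "\<^bold>\<turnstile> \<alpha> \<Longrightarrow> \<^bold>\<turnstile> \<alpha> \<^bold>\<Rightarrow> \<beta> \<Longrightarrow> \<^bold>\<turnstile> \<beta>"
| R2: "\<^bold>\<turnstile> \<alpha> \<Longrightarrow> variable x \<Longrightarrow> object \<beta> \<Longrightarrow> \<^bold>\<turnstile> \<alpha>\<^bold>[x \<^bold>:= \<beta>\<^bold>]"
| R3: "\<^bold>\<turnstile> \<gamma> \<^bold>\<Rightarrow> (\<alpha> \<^bold>\<Rightarrow> \<beta>) \<Longrightarrow> variable x \<Longrightarrow> x \<notin> fv \<gamma> \<Longrightarrow>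
    \<^bold>\<turnstile> \<gamma> \<^bold>\<Rightarrow> (\<^bold>{x \<^bold>| \<beta>\<^bold>} \<^bold>\<Rightarrow> \<^bold>{x \<^bold>| \<alpha>\<^bold>})"
| A1: "variable a \<Longrightarrow> variable b \<Longrightarrow> variable c \<Longrightarrow>
    \<^bold>\<turnstile> ((c \<^bold>\<Rightarrow> a) \<^bold>& (c \<^bold>\<Rightarrow> (a \<^bold>\<Rightarrow> b))) \<^bold>\<Rightarrow> (c \<^bold>\<Rightarrow> b)"
| A2: "variable a \<Longrightarrow> variable b \<Longrightarrow> variable c \<Longrightarrow> variable d \<Longrightarrow>
    \<^bold>\<turnstile> ((d \<^bold>\<Rightarrow> (a \<^bold>\<Rightarrow> b)) \<^bold>& (d \<^bold>\<Rightarrow> (b \<^bold>\<Rightarrow> c))) \<^bold>\<Rightarrow> (d \<^bold>\<Rightarrow> (a \<^bold>\<Rightarrow> c))"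
| A3: "variable a \<Longrightarrow> variable b \<Longrightarrow> variable c \<Longrightarrow>
    \<^bold>\<turnstile> ((c \<^bold>\<Rightarrow> a) \<^bold>& (c \<^bold>\<Rightarrow> b)) \<^bold>\<Rightarrow> (c \<^bold>\<Rightarrow> (a \<^bold>& b))"
| A4a: "variable a \<Longrightarrow> variable b \<Longrightarrow> \<^bold>\<turnstile> (a \<^bold>& b) \<^bold>\<Rightarrow> a"
| A4b: "variable a \<Longrightarrow> variable b \<Longrightarrow> \<^bold>\<turnstile> (a \<^bold>& b) \<^bold>\<Rightarrow> b"
| A5a: "variable a \<Longrightarrow> variable b \<Longrightarrow> \<^bold>\<turnstile> a \<^bold>\<Rightarrow> (a \<^bold>\<inter> b)"
| A5b: "variable a \<Longrightarrow> variable b \<Longrightarrow> \<^bold>\<turnstile> b \<^bold>\<Rightarrow> (a \<^bold>\<inter> b)"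
| A6: "variable a \<Longrightarrow> variable b \<Longrightarrow> variable c \<Longrightarrow>
    \<^bold>\<turnstile> ((a \<^bold>\<Rightarrow> c) \<^bold>& (b \<^bold>\<Rightarrow> c)) \<^bold>\<Rightarrow> ((a \<^bold>\<inter> b) \<^bold>\<Rightarrow> c)"
| A7: "variable a \<Longrightarrow> \<^bold>\<turnstile> a \<^bold>\<Rightarrow> a"
| A8: "variable a \<Longrightarrow> \<^bold>\<turnstile> a \<^bold>\<Rightarrow> \<^bold>\<emptyset>"
| A9: "variable a \<Longrightarrow> \<^bold>\<turnstile> \<^bold>\<bottom> \<^bold>\<Rightarrow> a"
| A10: "variable a \<Longrightarrow> variable b \<Longrightarrow>
    \<^bold>\<turnstile> (\<^bold>\<emptyset> \<^bold>\<Rightarrow> a) \<^bold>\<Rightarrow> ((\<^bold>\<emptyset> \<^bold>\<Rightarrow> b) \<^bold>\<Rightarrow> (a \<^bold>& b))"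
| A11: "variable a \<Longrightarrow> variable b \<Longrightarrow> \<^bold>\<turnstile> (a \<^bold>\<Rightarrow> b) \<^bold>\<Rightarrow> (\<^bold>\<emptyset> \<^bold>\<Rightarrow> (a \<^bold>\<Rightarrow> b))"
| A12: "variable a \<Longrightarrow> variable b \<Longrightarrow> \<^bold>\<turnstile> (((a \<^bold>\<Rightarrow> b) \<^bold>\<Rightarrow> \<^bold>\<bottom>) \<^bold>\<Rightarrow> \<^bold>\<bottom>) \<^bold>\<Rightarrow> (a \<^bold>\<Rightarrow> b)"
| A13: "variable a \<Longrightarrow> variable x \<Longrightarrow> variable y \<Longrightarrow> object \<alpha> \<Longrightarrow> y \<noteq> a \<Longrightarrow>
    \<^bold>\<turnstile> (a \<^bold>\<in>\<^bsub>y\<^esub> \<^bold>{x \<^bold>| \<alpha>\<^bold>}) \<^bold>= (Sing y a \<^bold>& \<alpha>\<^bold>[x \<^bold>:= a\<^bold>])"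
| A14a: "variable a \<Longrightarrow> variable x \<Longrightarrow> variable y \<Longrightarrow> x \<noteq> a \<Longrightarrow> y \<noteq> a \<Longrightarrow> y \<noteq> x \<Longrightarrow>
    \<^bold>\<turnstile> a \<^bold>\<Rightarrow> \<^bold>{x \<^bold>| x \<^bold>\<in>\<^bsub>y\<^esub> a\<^bold>}"
| A14b: "variable a \<Longrightarrow> variable x \<Longrightarrow> variable y \<Longrightarrow> x \<noteq> a \<Longrightarrow> y \<noteq> a \<Longrightarrow> y \<noteq> x \<Longrightarrow>
    \<^bold>\<turnstile> (\<^bold>V \<^bold>\<Rightarrow> a) \<^bold>\<Rightarrow> (\<^bold>{x \<^bold>| x \<^bold>\<in>\<^bsub>y\<^esub> a\<^bold>} \<^bold>\<Rightarrow> a)"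

lemma compr_Emp: "\<^bold>{x \<^bold>| \<^bold>\<emptyset>\<^bold>} = \<^bold>V"
  by (simp add: compr_def univ_def)

lemma fv_bind: "fv (bind k x t) = fv t - {x}"
  by (induction t arbitrary: k) auto

lemma fv_compr: "fv \<^bold>{x \<^bold>| \<beta>\<^bold>} = fv \<beta> - {x}"
  by (simp add: compr_def fv_bind)

lemma bind_fresh: "x \<notin> fv t \<Longrightarrow> bind k x t = t"
  by (induction t arbitrary: k) auto

lemma subst_fresh: "x \<notin> fv t \<Longrightarrow> t\<^bold>[x \<^bold>:= r\<^bold>] = t"
  by (induction t) auto

text \<open>Renaming of bound indices, and substitution below a class.\<close>

lemma bind_rename: "z \<notin> fv t \<Longrightarrow> variable z \<Longrightarrow> bind k z (t\<^bold>[x \<^bold>:= z\<^bold>]) = bind k x t"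
  by (induction t arbitrary: k) (auto simp: variable_def)

lemma compr_rename: "z \<notin> fv \<beta> \<Longrightarrow> variable z \<Longrightarrow> \<^bold>{z \<^bold>| \<beta>\<^bold>[x \<^bold>:= z\<^bold>]\<^bold>} = \<^bold>{x \<^bold>| \<beta>\<^bold>}"
  by (simp add: compr_def bind_rename)

lemma subst_compr_same: "\<^bold>{x \<^bold>| \<beta>\<^bold>}\<^bold>[x \<^bold>:= r\<^bold>] = \<^bold>{x \<^bold>| \<beta>\<^bold>}"
  by (metis Diff_iff fv_compr insertI1 subst_fresh)

lemma subst_compr:
  assumes "x \<noteq> z" "x \<notin> fv r"
  shows "\<^bold>{x \<^bold>| \<beta>\<^bold>}\<^bold>[z \<^bold>:= r\<^bold>] = \<^bold>{x \<^bold>| \<beta>\<^bold>[z \<^bold>:= r\<^bold>]\<^bold>}"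
proof -
  have "(bind k x t)\<^bold>[z \<^bold>:= r\<^bold>] = bind k x (t\<^bold>[z \<^bold>:= r\<^bold>])" for k t
    using assms by (induction t arbitrary: k) (auto simp: bind_fresh)
  then show ?thesis by (simp add: compr_def)
qed

end

theory Submission
  imports Defs
begin

text \<open>
  Under the two hypotheses, \<open>b \<Rightarrow> {x | x \<in> b} \<Rightarrow> {x | x \<in> a} \<Rightarrow> a\<close> by \<open>A14a\<close>, the second hypothesis and
  \<open>A14b\<close>; these steps compose by \<open>A2\<close>. The axioms include neither weakening nor adjunction for
  arbitrary objects, but the hypotheses and theorems composed here are implications, which \<open>A11\<close>
  prefixes with \<open>\<emptyset>\<close>; weakening then follows from \<open>A8\<close>, and adjunction from \<open>A10\<close>.
\<close>

lemma object_variable: "variable x \<Longrightarrow> object x"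
  by (auto simp: variable_def intro: object.intros)

lemma object_falsum: "object \<^bold>\<bottom>"
  by (simp add: falsum_def object.intros)

lemma object_compr: "variable x \<Longrightarrow> object \<beta> \<Longrightarrow> object \<^bold>{x \<^bold>| \<beta>\<^bold>}"
  using obj_compr obj_Var by (auto simp: variable_def)

lemma object_univ: "object \<^bold>V"
  unfolding univ_def by (intro object.intros)

text \<open>\<open>R2\<close> inserts only objects, so the classes of the form
  \<open>{x | x \<in> a}\<close> must be known to be objects before they can enter an instance of an
  axiom.\<close>

lemma object_mem: "object a \<Longrightarrow> object b \<Longrightarrow> object y \<Longrightarrow> object (a \<^bold>\<in>\<^bsub>y\<^esub> b)"
  by (simp add: mem_def Sing_def neq_def neg_def eq_def disj_def bar_def object_falsum object.intros)

lemma subst_variable: "variable z \<Longrightarrow> z\<^bold>[x \<^bold>:= r\<^bold>] = (if z = x then r else z)"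
  by (auto simp: variable_def)

lemma fv_variable: "variable z \<Longrightarrow> fv z = {z}"
  by (auto simp: variable_def)

lemma finite_fv: "finite (fv t)"
  by (induction t) auto

text \<open>Any object can serve as the name of a variable, so the iterates of \<open>Con\<close> on
  \<open>\<emptyset>\<close> already give infinitely many variables. This makes fresh variables
  available outside every finite set.\<close>

lemma infinite_variables: "infinite (Collect variable)"
proof -
  have obj: "object ((Con ^^ n) \<^bold>\<emptyset>)" for n
    by (induction n) (auto intro: object.intros)
  have inj: "(Con ^^ m) \<^bold>\<emptyset> = (Con ^^ n) \<^bold>\<emptyset> \<Longrightarrow> m = n" for m n
  proof (induction m arbitrary: n)
    case 0
    then show ?case by (cases n) auto
  next
    case (Suc m)
    then show ?case by (cases n) auto
  qed
  have "inj (\<lambda>n. Var ((Con ^^ n) \<^bold>\<emptyset>))"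
    using inj by (auto intro!: injI)
  moreover have "range (\<lambda>n. Var ((Con ^^ n) \<^bold>\<emptyset>)) \<subseteq> Collect variable"
    using obj by (auto simp: variable_def)
  ultimately show ?thesis
    by (meson finite_imageD finite_subset infinite_UNIV_nat)
qed

lemma fresh_variable:
  assumes "finite S"
  shows "\<exists>z. variable z \<and> z \<notin> S"
  using infinite_variables finite_subset[OF _ assms, of "Collect variable"] by auto

lemma fresh_variable_pair:
  assumes "finite S"
  shows "\<exists>a b. variable a \<and> variable b \<and> a \<notin> S \<and> b \<notin> S \<and> a \<noteq> b"
proof -
  obtain a where a: "variable a" "a \<notin> S"
    using fresh_variable[OF assms] by auto
  obtain b where "variable b" "b \<notin> insert a S"
    using fresh_variable[of "insert a S"] assms by auto
  with a show ?thesis by auto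
qed

text \<open>\<open>A2\<close> speaks of variables only, and \<open>R2\<close> replaces one variable
  at a time. The four variables are distinct and not free in the objects inserted, so no
  substitution disturbs the result of an earlier one, and the four in succession act simultaneously.
  Instances of the other axioms with several variables are obtained in the same way.\<close>

lemma trans_instance:
  assumes "object \<alpha>" "object \<beta>" "object \<gamma>" "object \<delta>"
  shows "\<^bold>\<turnstile> ((\<delta> \<^bold>\<Rightarrow> (\<alpha> \<^bold>\<Rightarrow> \<beta>)) \<^bold>& (\<delta> \<^bold>\<Rightarrow> (\<beta> \<^bold>\<Rightarrow> \<gamma>))) \<^bold>\<Rightarrow> (\<delta> \<^bold>\<Rightarrow> (\<alpha> \<^bold>\<Rightarrow> \<gamma>))"
proof -
  let ?S = "fv \<alpha> \<union> fv \<beta> \<union> fv \<gamma> \<union> fv \<delta>"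
  obtain a b where ab: "variable a" "variable b" "a \<notin> ?S" "b \<notin> ?S" "a \<noteq> b"
    using fresh_variable_pair[of ?S] by (auto simp: finite_fv)
  obtain c d where cd: "variable c" "variable d" "c \<notin> {a, b} \<union> ?S" "d \<notin> {a, b} \<union> ?S" "c \<noteq> d"
    using fresh_variable_pair[of "{a, b} \<union> ?S"] by (auto simp: finite_fv)
  have "\<^bold>\<turnstile> (((d \<^bold>\<Rightarrow> (a \<^bold>\<Rightarrow> b)) \<^bold>& (d \<^bold>\<Rightarrow> (b \<^bold>\<Rightarrow> c))) \<^bold>\<Rightarrow> (d \<^bold>\<Rightarrow> (a \<^bold>\<Rightarrow> c)))\<^bold>[a \<^bold>:= \<alpha>\<^bold>]\<^bold>[b \<^bold>:= \<beta>\<^bold>]\<^bold>[c \<^bold>:= \<gamma>\<^bold>]\<^bold>[d \<^bold>:= \<delta>\<^bold>]"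
    using ab cd assms by (intro R2 A2)
  then show ?thesis
    using ab cd by (simp add: subst_variable subst_fresh)
qed

lemma adjunction_instance:
  assumes "object \<alpha>" "object \<beta>"
  shows "\<^bold>\<turnstile> (\<^bold>\<emptyset> \<^bold>\<Rightarrow> \<alpha>) \<^bold>\<Rightarrow> ((\<^bold>\<emptyset> \<^bold>\<Rightarrow> \<beta>) \<^bold>\<Rightarrow> (\<alpha> \<^bold>& \<beta>))"
proof -
  obtain a b where ab: "variable a" "variable b"
    "a \<notin> fv \<alpha> \<union> fv \<beta>" "b \<notin> fv \<alpha> \<union> fv \<beta>" "a \<noteq> b"
    using fresh_variable_pair[of "fv \<alpha> \<union> fv \<beta>"] by (auto simp: finite_fv)
  have "\<^bold>\<turnstile> ((\<^bold>\<emptyset> \<^bold>\<Rightarrow> a) \<^bold>\<Rightarrow> ((\<^bold>\<emptyset> \<^bold>\<Rightarrow> b) \<^bold>\<Rightarrow> (a \<^bold>& b)))\<^bold>[a \<^bold>:= \<alpha>\<^bold>]\<^bold>[b \<^bold>:= \<beta>\<^bold>]"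
    using ab assms by (intro R2 A10)
  then show ?thesis
    using ab by (simp add: subst_variable subst_fresh)
qed

lemma boxed_instance:
  assumes "object \<alpha>" "object \<beta>"
  shows "\<^bold>\<turnstile> (\<alpha> \<^bold>\<Rightarrow> \<beta>) \<^bold>\<Rightarrow> (\<^bold>\<emptyset> \<^bold>\<Rightarrow> (\<alpha> \<^bold>\<Rightarrow> \<beta>))"
proof -
  obtain a b where ab: "variable a" "variable b"
    "a \<notin> fv \<alpha> \<union> fv \<beta>" "b \<notin> fv \<alpha> \<union> fv \<beta>" "a \<noteq> b"
    using fresh_variable_pair[of "fv \<alpha> \<union> fv \<beta>"] by (auto simp: finite_fv)
  have "\<^bold>\<turnstile> ((a \<^bold>\<Rightarrow> b) \<^bold>\<Rightarrow> (\<^bold>\<emptyset> \<^bold>\<Rightarrow> (a \<^bold>\<Rightarrow> b)))\<^bold>[a \<^bold>:= \<alpha>\<^bold>]\<^bold>[b \<^bold>:= \<beta>\<^bold>]"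
    using ab assms by (intro R2 A11)
  then show ?thesis
    using ab by (simp add: subst_variable subst_fresh)
qed

lemma fed_left_instance:
  assumes "object \<alpha>" "object \<beta>"
  shows "\<^bold>\<turnstile> (\<alpha> \<^bold>& \<beta>) \<^bold>\<Rightarrow> \<alpha>"
proof -
  obtain a b where ab: "variable a" "variable b"
    "a \<notin> fv \<alpha> \<union> fv \<beta>" "b \<notin> fv \<alpha> \<union> fv \<beta>" "a \<noteq> b"
    using fresh_variable_pair[of "fv \<alpha> \<union> fv \<beta>"] by (auto simp: finite_fv)
  have "\<^bold>\<turnstile> ((a \<^bold>& b) \<^bold>\<Rightarrow> a)\<^bold>[a \<^bold>:= \<alpha>\<^bold>]\<^bold>[b \<^bold>:= \<beta>\<^bold>]"
    using ab assms by (intro R2 A4a)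
  then show ?thesis
    using ab by (simp add: subst_variable subst_fresh)
qed

lemma fed_right_instance:
  assumes "object \<alpha>" "object \<beta>"
  shows "\<^bold>\<turnstile> (\<alpha> \<^bold>& \<beta>) \<^bold>\<Rightarrow> \<beta>"
proof -
  obtain a b where ab: "variable a" "variable b"
    "a \<notin> fv \<alpha> \<union> fv \<beta>" "b \<notin> fv \<alpha> \<union> fv \<beta>" "a \<noteq> b"
    using fresh_variable_pair[of "fv \<alpha> \<union> fv \<beta>"] by (auto simp: finite_fv)
  have "\<^bold>\<turnstile> ((a \<^bold>& b) \<^bold>\<Rightarrow> b)\<^bold>[a \<^bold>:= \<alpha>\<^bold>]\<^bold>[b \<^bold>:= \<beta>\<^bold>]"
    using ab assms by (intro R2 A4b)
  then show ?thesis
    using ab by (simp add: subst_variable subst_fresh)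
qed

lemma top_instance:
  assumes "object \<alpha>"
  shows "\<^bold>\<turnstile> \<alpha> \<^bold>\<Rightarrow> \<^bold>\<emptyset>"
proof -
  \<comment> \<open>Only one substitution follows, so nothing inserted is substituted into again and
    any variable will do.\<close>
  obtain a where v: "variable a"
    using fresh_variable[OF finite.emptyI] by auto
  have "\<^bold>\<turnstile> (a \<^bold>\<Rightarrow> \<^bold>\<emptyset>)\<^bold>[a \<^bold>:= \<alpha>\<^bold>]"
    using v assms by (intro R2 A8)
  then show ?thesis
    using v by (simp add: subst_variable)
qed

text \<open>\<open>A8\<close> yields both \<open>\<emptyset> \<Rightarrow> \<emptyset>\<close> and
  \<open>(\<emptyset> \<Rightarrow> \<emptyset>) \<Rightarrow> \<emptyset>\<close>; detach.\<close>

lemma derivable_Emp: "\<^bold>\<turnstile> \<^bold>\<emptyset>"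
  using R1[OF top_instance top_instance, OF obj_Emp obj_Imp] obj_Emp by simp

lemma boxed:
  assumes "\<^bold>\<turnstile> \<alpha> \<^bold>\<Rightarrow> \<beta>" "object \<alpha>" "object \<beta>"
  shows "\<^bold>\<turnstile> \<^bold>\<emptyset> \<^bold>\<Rightarrow> (\<alpha> \<^bold>\<Rightarrow> \<beta>)"
  by (rule R1[OF assms(1) boxed_instance[OF assms(2,3)]])

text \<open>\<open>A2\<close> composes implications under a hypothesis \<open>\<delta>\<close>, but
  takes its two premises as one federation. Both are implications, so \<open>A11\<close> gives them
  the prefix \<open>\<emptyset>\<close> that \<open>A10\<close> demands before joining them.\<close>

lemma imp_trans_under:
  assumes "\<^bold>\<turnstile> \<delta> \<^bold>\<Rightarrow> (\<alpha> \<^bold>\<Rightarrow> \<beta>)" "\<^bold>\<turnstile> \<delta> \<^bold>\<Rightarrow> (\<beta> \<^bold>\<Rightarrow> \<gamma>)"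
    and obj: "object \<alpha>" "object \<beta>" "object \<gamma>" "object \<delta>"
  shows "\<^bold>\<turnstile> \<delta> \<^bold>\<Rightarrow> (\<alpha> \<^bold>\<Rightarrow> \<gamma>)"
proof -
  have box: "\<^bold>\<turnstile> \<^bold>\<emptyset> \<^bold>\<Rightarrow> (\<delta> \<^bold>\<Rightarrow> (\<alpha> \<^bold>\<Rightarrow> \<beta>))" "\<^bold>\<turnstile> \<^bold>\<emptyset> \<^bold>\<Rightarrow> (\<delta> \<^bold>\<Rightarrow> (\<beta> \<^bold>\<Rightarrow> \<gamma>))"
    using assms by (simp_all add: boxed obj_Imp)
  have "\<^bold>\<turnstile> (\<delta> \<^bold>\<Rightarrow> (\<alpha> \<^bold>\<Rightarrow> \<beta>)) \<^bold>& (\<delta> \<^bold>\<Rightarrow> (\<beta> \<^bold>\<Rightarrow> \<gamma>))"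
    by (rule R1[OF box(2) R1[OF box(1) adjunction_instance]]) (simp_all add: obj obj_Imp)
  then show ?thesis
    by (rule R1[OF _ trans_instance[OF obj]])
qed

lemma imp_trans:
  assumes "\<^bold>\<turnstile> \<alpha> \<^bold>\<Rightarrow> \<beta>" "\<^bold>\<turnstile> \<beta> \<^bold>\<Rightarrow> \<gamma>" "object \<alpha>" "object \<beta>" "object \<gamma>"
  shows "\<^bold>\<turnstile> \<alpha> \<^bold>\<Rightarrow> \<gamma>"
\<comment> \<open>Plain composition is composition under the hypothesis \<open>\<emptyset>\<close>,
  which is then detached.\<close>
proof (rule R1[OF derivable_Emp])
  show "\<^bold>\<turnstile> \<^bold>\<emptyset> \<^bold>\<Rightarrow> (\<alpha> \<^bold>\<Rightarrow> \<gamma>)"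
    using imp_trans_under[OF boxed[OF assms(1,3,4)] boxed[OF assms(2,4,5)]] assms obj_Emp by simp
qed

lemma imp_weaken:
  assumes "\<^bold>\<turnstile> \<alpha> \<^bold>\<Rightarrow> \<beta>" "object \<alpha>" "object \<beta>" "object \<delta>"
  shows "\<^bold>\<turnstile> \<delta> \<^bold>\<Rightarrow> (\<alpha> \<^bold>\<Rightarrow> \<beta>)"
  by (rule imp_trans[OF top_instance boxed]) (use assms in \<open>simp_all add: object.intros\<close>)

text \<open>The point is to derive \<open>P \<Rightarrow> (Q \<Rightarrow> (P & Q))\<close>.
  \<open>A10\<close> gives this only with \<open>P\<close> and \<open>Q\<close> prefixed by
  \<open>\<emptyset>\<close>; since both are implications, \<open>A11\<close> supplies the
  prefixes.\<close>

lemma curry_implications: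
  assumes "\<^bold>\<turnstile> ((\<alpha> \<^bold>\<Rightarrow> \<beta>) \<^bold>& (\<gamma> \<^bold>\<Rightarrow> \<delta>)) \<^bold>\<Rightarrow> \<epsilon>"
    and obj: "object \<alpha>" "object \<beta>" "object \<gamma>" "object \<delta>" "object \<epsilon>"
  shows "\<^bold>\<turnstile> (\<alpha> \<^bold>\<Rightarrow> \<beta>) \<^bold>\<Rightarrow> ((\<gamma> \<^bold>\<Rightarrow> \<delta>) \<^bold>\<Rightarrow> \<epsilon>)"
proof -
  let ?P = "\<alpha> \<^bold>\<Rightarrow> \<beta>" and ?Q = "\<gamma> \<^bold>\<Rightarrow> \<delta>"
  have o: "object ?P" "object ?Q" "object (?P \<^bold>& ?Q)" "object (\<^bold>\<emptyset> \<^bold>\<Rightarrow> ?P)" "object (\<^bold>\<emptyset> \<^bold>\<Rightarrow> ?Q)"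
    using obj by (simp_all add: object.intros)
  have "\<^bold>\<turnstile> ?P \<^bold>\<Rightarrow> (?Q \<^bold>\<Rightarrow> (\<^bold>\<emptyset> \<^bold>\<Rightarrow> ?Q))"
    using imp_weaken boxed_instance obj o by simp
  moreover have "\<^bold>\<turnstile> ?P \<^bold>\<Rightarrow> ((\<^bold>\<emptyset> \<^bold>\<Rightarrow> ?Q) \<^bold>\<Rightarrow> (?P \<^bold>& ?Q))"
    using imp_trans[OF boxed_instance adjunction_instance] obj o by (simp add: obj_Imp)
  ultimately have "\<^bold>\<turnstile> ?P \<^bold>\<Rightarrow> (?Q \<^bold>\<Rightarrow> (?P \<^bold>& ?Q))"
    by (rule imp_trans_under) (use o in simp_all)
  moreover have "\<^bold>\<turnstile> ?P \<^bold>\<Rightarrow> ((?P \<^bold>& ?Q) \<^bold>\<Rightarrow> \<epsilon>)"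
    using imp_weaken assms o by simp
  ultimately show ?thesis
    by (rule imp_trans_under) (use o obj in simp_all)
qed

text \<open>
  \<open>y = a\<close> is allowed in the theorem but not in \<open>A14a\<close> and \<open>A14b\<close>, so \<open>y\<close> is substituted for a
  fresh variable.
\<close>

lemma extension_subst:
  assumes "variable a" "variable x" "variable y" "variable z"
    and "x \<noteq> a" "y \<noteq> x" "z \<noteq> x" "z \<noteq> a"
  shows "\<^bold>{x \<^bold>| x \<^bold>\<in>\<^bsub>z\<^esub> a\<^bold>}\<^bold>[z \<^bold>:= y\<^bold>] = \<^bold>{x \<^bold>| x \<^bold>\<in>\<^bsub>y\<^esub> a\<^bold>}"
  using assms
  by (simp add: subst_compr fv_variable subst_variable mem_def Sing_def neq_def neg_def eq_def
      disj_def bar_def falsum_def)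

lemma extension_below:
  assumes "variable a" "variable x" "variable y" "x \<noteq> a" "y \<noteq> x"
  shows "\<^bold>\<turnstile> a \<^bold>\<Rightarrow> \<^bold>{x \<^bold>| x \<^bold>\<in>\<^bsub>y\<^esub> a\<^bold>}"
proof -
  obtain z where z: "variable z" "z \<noteq> x" "z \<noteq> a" "a \<noteq> z"
    using fresh_variable[of "{a, x}"] by auto
  have "\<^bold>\<turnstile> (a \<^bold>\<Rightarrow> \<^bold>{x \<^bold>| x \<^bold>\<in>\<^bsub>z\<^esub> a\<^bold>})\<^bold>[z \<^bold>:= y\<^bold>]"
    using assms z by (intro R2 A14a) (auto intro: object_variable)
  then show ?thesis
    using assms z by (simp add: extension_subst subst_variable)
qed

lemma extension_above:
  assumes "variable a" "variable x" "variable y" "x \<noteq> a" "y \<noteq> x"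
  shows "\<^bold>\<turnstile> (\<^bold>V \<^bold>\<Rightarrow> a) \<^bold>\<Rightarrow> (\<^bold>{x \<^bold>| x \<^bold>\<in>\<^bsub>y\<^esub> a\<^bold>} \<^bold>\<Rightarrow> a)"
proof -
  obtain z where z: "variable z" "z \<noteq> x" "z \<noteq> a" "a \<noteq> z"
    using fresh_variable[of "{a, x}"] by auto
  have "\<^bold>\<turnstile> ((\<^bold>V \<^bold>\<Rightarrow> a) \<^bold>\<Rightarrow> (\<^bold>{x \<^bold>| x \<^bold>\<in>\<^bsub>z\<^esub> a\<^bold>} \<^bold>\<Rightarrow> a))\<^bold>[z \<^bold>:= y\<^bold>]"
    using assms z by (intro R2 A14b) (auto intro: object_variable)
  \<comment> \<open>\<open>V\<close> can be written with \<open>z\<close> as its index, and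
    substitution for the index of a class changes nothing.\<close>
  moreover have "\<^bold>V\<^bold>[z \<^bold>:= y\<^bold>] = \<^bold>V"
    by (metis compr_Emp subst_compr_same)
  ultimately show ?thesis
    using assms z by (simp add: extension_subst subst_variable)
qed

theorem theorem3p12:
  fixes a b x y :: expr
  assumes "variable a" and "variable b" and "variable x" and "variable y"
    and "x \<noteq> a" and "x \<noteq> b" and "y \<noteq> x"
  shows "\<^bold>\<turnstile> (a \<^bold>\<sqsubseteq> \<^bold>V) \<^bold>\<Rightarrow>
    ((\<^bold>{x \<^bold>| x \<^bold>\<in>\<^bsub>y\<^esub> a\<^bold>} \<^bold>\<sqsubseteq> \<^bold>{x \<^bold>| x \<^bold>\<in>\<^bsub>y\<^esub> b\<^bold>}) \<^bold>\<Rightarrow> (a \<^bold>\<sqsubseteq> b))"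
proof -
  let ?A = "\<^bold>{x \<^bold>| x \<^bold>\<in>\<^bsub>y\<^esub> a\<^bold>}" and ?B = "\<^bold>{x \<^bold>| x \<^bold>\<in>\<^bsub>y\<^esub> b\<^bold>}"
  let ?P = "\<^bold>V \<^bold>\<Rightarrow> a" and ?Q = "?B \<^bold>\<Rightarrow> ?A"
  have o: "object a" "object b" "object ?A" "object ?B"
    using assms by (simp_all add: object_variable object_compr object_mem)
  then have oD: "object ?P" "object ?Q" "object (?P \<^bold>& ?Q)"
    by (simp_all add: object_univ object.intros)
  \<comment> \<open>Both hypotheses are collected in \<open>?P & ?Q\<close>, under which the chain
    from \<open>b\<close> through \<open>?B\<close> and \<open>?A\<close> to \<open>a\<close> is
    composed.\<close>
  have "\<^bold>\<turnstile> (?P \<^bold>& ?Q) \<^bold>\<Rightarrow> (b \<^bold>\<Rightarrow> ?B)"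
    using assms o oD by (simp add: imp_weaken extension_below)
  moreover have "\<^bold>\<turnstile> (?P \<^bold>& ?Q) \<^bold>\<Rightarrow> (?B \<^bold>\<Rightarrow> ?A)"
    using oD by (simp add: fed_right_instance)
  ultimately have "\<^bold>\<turnstile> (?P \<^bold>& ?Q) \<^bold>\<Rightarrow> (b \<^bold>\<Rightarrow> ?A)"
    by (rule imp_trans_under) (use o oD in simp_all)
  \<comment> \<open>Here \<open>a \<sqsubseteq> V\<close> enters: it is \<open>?P\<close>, the
    premise of \<open>A14b\<close>.\<close>
  moreover have "\<^bold>\<turnstile> (?P \<^bold>& ?Q) \<^bold>\<Rightarrow> (?A \<^bold>\<Rightarrow> a)"
    using imp_trans[OF fed_left_instance extension_above] assms o oD by (simp add: obj_Imp)
  ultimately have "\<^bold>\<turnstile> (?P \<^bold>& ?Q) \<^bold>\<Rightarrow> (b \<^bold>\<Rightarrow> a)"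
    by (rule imp_trans_under) (use o oD in simp_all)
  \<comment> \<open>Unfolding \<open>\<sqsubseteq>\<close> shows both hypotheses to be implications,
    as currying requires.\<close>
  then show ?thesis
    unfolding sub_def using o by (simp add: curry_implications object_univ obj_Imp)
qed

end
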